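(* Let $\mathcal E$ be a finitely complete category equipped with a cloven weak factorisation system which is functorially Frobenius and has a stable functorial choice of diagonal factorisations (that is, $\mathcal E$ is a homotopy-theoretic model of identity types). Then the type category with category of contexts $\mathcal E$, whose types over $\Gamma$ are the cloven $\mathcal R$-maps with codomain $\Gamma$ (with $\Gamma.A$ the domain of the map, $\pi_A$ the map itself, and substitution given by pullback equipped with the induced cloven $\mathcal R$-map structure), carries strong identity types; i.e. $\mathcal E$ is a categorical model of identity types.
   Context: A cloven weak factorisation system (cloven w.f.s.) on a category $\mathcal E$ consists of: for each $f\colon X\to Y$ a factorisation $f=\rho_f\lambda_f$ with $\lambda_f\colon X\to Pf$, $\rho_f\colon Pf\to Y$; for each commutative square $gh=kf$ (with $f\colon U\to V$, $g\colon X\to Y$, $h\colon U\to X$, $k\colon V\to Y$) a map $P(h,k)\colon Pf\to Pg$ with $P(h,k)\lambda_f=\lambda_g h$ and $\rho_g P(h,k)=k\rho_f$, functorial in $(h,k)$; and for each $f$ maps $\sigma_f\colon Pf\to P\lambda_f$ with $\sigma_f\lambda_f=\lambda_{\lambda_f}$, $\rho_{\lambda_f}\sigma_f=1$, and $\pi_f\colon P\rho_f\to Pf$ with $\pi_f\lambda_{\rho_f}=1$, $\rho_f\pi_f=\rho_{\rho_f}$. A cloven $\mathcal L$-map $(f,s)$ is $f\colon X\to Y$ with $s\colon Y\to Pf$, $sf=\lambda_f$, $\rho_f s=1_Y$; a cloven $\mathcal R$-map $(f,p)$ is $f\colon X\to Y$ with $p\colon Pf\to X$, $p\lambda_f=1_X$,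 $fp=\rho_f$. A morphism of cloven $\mathcal L$-maps $(f,s)\to(g,t)$ is a commutative square $(h,k)$ from $f$ to $g$ with $P(h,k)s=tk$; a morphism of cloven $\mathcal R$-maps $(f,p)\to(g,q)$ is a commutative square $(h,k)$ with $qP(h,k)=hp$. These form categories $\mathcal L\text{-Map}$, $\mathcal R\text{-Map}$, with forgetful functors to the arrow category. A choice of diagonal factorisations assigns to each cloven $\mathcal R$-map $(x,p)\colon X\to\Gamma$ a factorisation $X\xrightarrow{i_x}I(x)\xrightarrow{j_x}X\times_\Gamma X$ of the diagonal, with a cloven $\mathcal L$-map structure on $i_x$ and a cloven $\mathcal R$-map structure on $j_x$. It is functorial if for each morphism of cloven $\mathcal R$-maps $(f,g)\colon(x,p)\to(y,q)$ there is $I(f,g)\colon I(x)\to I(y)$, functorially, such that $(f,I(f,g))$ is a morphism of cloven $\mathcal L$-maps $i_x\to i_y$ and $(I(f,g),f\times_g f)$ is a morphism of cloven $\mathcal R$-maps $j_x\to j_y$. It is stable if whenever the square underlying $(f,g)$ is a pullback, so is the square $(I(f,g),f\times_gf)$ from $j_x$ to $j_y$. The cloven w.f.s. is functorially Frobenius if for every pullback $\bar\imath\colon f^*X\to B$ of a cloven $\mathcal L$-map $i\colon X\to A$ along a cloven $\mathcal R$-map $f\colon B\to A$ there is assigned a cloven $\mathcal L$-map structure on $\bar\imath$, functorially, i.e. giving a functor $\mathcal R\text{-Map}\times_{\mathcal E}\mathcal L\text{-Map}\to\mathcal L\text{-Map}$. A type category consists of a category $\mathcal C$; for each $\Gamma$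 a collection $\mathrm{Ty}(\Gamma)$; for $A\in\mathrm{Ty}(\Gamma)$ an object $\Gamma.A$ and $\pi_A\colon\Gamma.A\to\Gamma$; for $f\colon\Delta\to\Gamma$ a type $A[f]\in\mathrm{Ty}(\Delta)$ and $f^+\colon\Delta.A[f]\to\Gamma.A$ such that $\pi_Af^+=f\pi_{A[f]}$ is a pullback square (no strict functoriality of substitution is required). For $A,B\in\mathrm{Ty}(\Gamma)$ write $B^+=B[\pi_A]$ and $\delta_A\colon\Gamma.A\to\Gamma.A.A^+$ for the diagonal. Strong identity types consist of $\mathrm{Id}_A\in\mathrm{Ty}(\Gamma.A.A^+)$ and $r_A\colon\Gamma.A\to\Gamma.A.A^+.\mathrm{Id}_A$ with $\pi_{\mathrm{Id}_A}r_A=\delta_A$, and, for every finite sequence of iterated types $B_1\in\mathrm{Ty}(\Gamma.A.A^+.\mathrm{Id}_A)$, \dots, $B_n$ (abbreviated $\Delta$), every $C\in\mathrm{Ty}(\Gamma.A.A^+.\mathrm{Id}_A.\Delta)$ and every $d\colon\Gamma.A.\Delta[r_A]\to\Gamma.A.A^+.\mathrm{Id}_A.\Delta.C$ with $\pi_Cd=(r_A)^{+\cdots+}$ (the map induced by $r_A$ on the pulled-back extensions), a map $J$ with $J(r_A)^{+\cdots+}=d$ and $\pi_CJ=1$; all of this stable under substitution along any $f\colon\Delta'\to\Gamma$ (the identity type and $r$ commute with the induced maps $f^{+},f^{++},f^{+++}$, and the chosen fillers for the substituted data are the substitutions of the chosen fillers). A categorical model of identity types is a type category with strong identity types. *)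

theory Defs
  imports Main
begin

section \<open>Categories, pullbacks, finite limits\<close>

record ('o, 'm) cat =
  Ob :: "'o set"
  Arr :: "'m set"
  Dom :: "'m \<Rightarrow> 'o"
  Cod :: "'m \<Rightarrow> 'o"
  One :: "'o \<Rightarrow> 'm"
  Comp :: "'m \<Rightarrow> 'm \<Rightarrow> 'm" (infixr "\<cdot>\<index>" 70)

text \<open>Composition is written in applicative order and is constrained only on composable pairs.\<close>

definition hom :: "('o, 'm) cat \<Rightarrow> 'o \<Rightarrow> 'o \<Rightarrow> 'm set" where
  "hom C a b = {f \<in> Arr C. Dom C f = a \<and> Cod C f = b}"

locale category =
  fixes C :: "('o, 'm) cat" (structure)
  assumes dom_cod: "f \<in> Arr C \<Longrightarrow> Dom C f \<in> Ob C \<and> Cod C f \<in> Ob C"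
    and one_hom: "a \<in> Ob C \<Longrightarrow> One C a \<in> hom C a a"
    and comp_hom: "f \<in> hom C a b \<Longrightarrow> g \<in> hom C b c \<Longrightarrow> g \<cdot> f \<in> hom C a c"
    and one_left: "f \<in> hom C a b \<Longrightarrow> One C b \<cdot> f = f"
    and one_right: "f \<in> hom C a b \<Longrightarrow> f \<cdot> One C a = f"
    and assoc: "f \<in> hom C a b \<Longrightarrow> g \<in> hom C b c \<Longrightarrow> h \<in> hom C c d \<Longrightarrow>
                 (h \<cdot> g) \<cdot> f = h \<cdot> (g \<cdot> f)"

text \<open>\<open>square C f g h k\<close>: the commutative square \<open>g h = k f\<close>, viewed as a map \<open>(h, k)\<close> from \<open>f\<close>
  to \<open>g\<close> in the arrow category.\<close>

definition square :: "('o, 'm) cat \<Rightarrow> 'm \<Rightarrow> 'm \<Rightarrow> 'm \<Rightarrow> 'm \<Rightarrow> bool" where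
  "square C f g h k \<longleftrightarrow> f \<in> Arr C \<and> g \<in> Arr C \<and>
     h \<in> hom C (Dom C f) (Dom C g) \<and> k \<in> hom C (Cod C f) (Cod C g) \<and>
     g \<cdot>\<^bsub>C\<^esub> h = k \<cdot>\<^bsub>C\<^esub> f"

text \<open>\<open>is_pullback C f g p q\<close>: the span \<open>(p, q)\<close> is a pullback of the cospan \<open>(f, g)\<close>, with
  \<open>f p = g q\<close>.\<close>

definition is_pullback :: "('o, 'm) cat \<Rightarrow> 'm \<Rightarrow> 'm \<Rightarrow> 'm \<Rightarrow> 'm \<Rightarrow> bool" where
  "is_pullback C f g p q \<longleftrightarrow>
     f \<in> Arr C \<and> g \<in> Arr C \<and> p \<in> Arr C \<and> q \<in> Arr C \<and> Cod C f = Cod C g \<and>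
     Dom C p = Dom C q \<and> Cod C p = Dom C f \<and> Cod C q = Dom C g \<and>
     f \<cdot>\<^bsub>C\<^esub> p = g \<cdot>\<^bsub>C\<^esub> q \<and>
     (\<forall>a. \<forall>u \<in> hom C a (Dom C f). \<forall>v \<in> hom C a (Dom C g). f \<cdot>\<^bsub>C\<^esub> u = g \<cdot>\<^bsub>C\<^esub> v \<longrightarrow>
        (\<exists>!w. w \<in> hom C a (Dom C p) \<and> p \<cdot>\<^bsub>C\<^esub> w = u \<and> q \<cdot>\<^bsub>C\<^esub> w = v))"

text \<open>A square, viewed as a map \<open>(h, k)\<close> from \<open>f\<close> to \<open>g\<close>, that is a pullback.\<close>

definition pullback_square :: "('o, 'm) cat \<Rightarrow> 'm \<Rightarrow> 'm \<Rightarrow> 'm \<Rightarrow> 'm \<Rightarrow> bool" where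
  "pullback_square C f g h k \<longleftrightarrow> square C f g h k \<and> is_pullback C k g f h"

text \<open>The map into a pullback with projections \<open>p, q\<close> induced by \<open>u, v\<close>.  It is only meaningful
  when \<open>(p, q)\<close> is a pullback of some cospan on which \<open>u, v\<close> agree.\<close>

definition induced :: "('o, 'm) cat \<Rightarrow> 'm \<Rightarrow> 'm \<Rightarrow> 'm \<Rightarrow> 'm \<Rightarrow> 'm" where
  "induced C p q u v =
     (THE w. w \<in> hom C (Dom C u) (Dom C p) \<and> p \<cdot>\<^bsub>C\<^esub> w = u \<and> q \<cdot>\<^bsub>C\<^esub> w = v)"

definition pullback_choice :: "('o, 'm) cat \<Rightarrow> ('m \<Rightarrow> 'm \<Rightarrow> 'm \<times> 'm) \<Rightarrow> bool" where
  "pullback_choice C pb \<longleftrightarrow>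
     (\<forall>f \<in> Arr C. \<forall>g \<in> Arr C. Cod C f = Cod C g \<longrightarrow>
        is_pullback C f g (fst (pb f g)) (snd (pb f g)))"

definition is_functor ::
  "('a, 'b) cat \<Rightarrow> ('o, 'm) cat \<Rightarrow> ('a \<Rightarrow> 'o) \<Rightarrow> ('b \<Rightarrow> 'm) \<Rightarrow> bool" where
  "is_functor J C Fo Fa \<longleftrightarrow>
     (\<forall>a \<in> Ob J. Fo a \<in> Ob C \<and> Fa (One J a) = One C (Fo a)) \<and>
     (\<forall>u \<in> Arr J. Fa u \<in> hom C (Fo (Dom J u)) (Fo (Cod J u))) \<and>
     (\<forall>u \<in> Arr J. \<forall>v \<in> Arr J. Cod J u = Dom J v \<longrightarrow> Fa (v \<cdot>\<^bsub>J\<^esub> u) = Fa v \<cdot>\<^bsub>C\<^esub> Fa u)"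

definition is_cone ::
  "('a, 'b) cat \<Rightarrow> ('o, 'm) cat \<Rightarrow> ('a \<Rightarrow> 'o) \<Rightarrow> ('b \<Rightarrow> 'm) \<Rightarrow> 'o \<Rightarrow> ('a \<Rightarrow> 'm) \<Rightarrow> bool" where
  "is_cone J C Fo Fa c l \<longleftrightarrow> c \<in> Ob C \<and> (\<forall>a \<in> Ob J. l a \<in> hom C c (Fo a)) \<and>
     (\<forall>u \<in> Arr J. Fa u \<cdot>\<^bsub>C\<^esub> l (Dom J u) = l (Cod J u))"

definition is_limit ::
  "('a, 'b) cat \<Rightarrow> ('o, 'm) cat \<Rightarrow> ('a \<Rightarrow> 'o) \<Rightarrow> ('b \<Rightarrow> 'm) \<Rightarrow> 'o \<Rightarrow> ('a \<Rightarrow> 'm) \<Rightarrow> bool" where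
  "is_limit J C Fo Fa c l \<longleftrightarrow> is_cone J C Fo Fa c l \<and>
     (\<forall>c' l'. is_cone J C Fo Fa c' l' \<longrightarrow>
        (\<exists>!w. w \<in> hom C c' c \<and> (\<forall>a \<in> Ob J. l a \<cdot>\<^bsub>C\<^esub> w = l' a)))"

text \<open>Every finite category is isomorphic to one whose objects and arrows are natural numbers, so
  it is enough to quantify over those.\<close>

definition finitely_complete :: "('o, 'm) cat \<Rightarrow> bool" where
  "finitely_complete C \<longleftrightarrow>
     (\<forall>(J :: (nat, nat) cat) Fo Fa.
        category J \<and> finite (Ob J) \<and> finite (Arr J) \<and> is_functor J C Fo Fa \<longrightarrow>
        (\<exists>c l. is_limit J C Fo Fa c l))"


section \<open>Cloven weak factorisation systems\<close>

text \<open>\<open>Pm W f g h k\<close> is the map \<open>P(h, k)\<close> for the square \<open>(h, k)\<close> from \<open>f\<close> to \<open>g\<close>.\<close>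

record 'm wfs =
  lam :: "'m \<Rightarrow> 'm"
  rho :: "'m \<Rightarrow> 'm"
  Pm :: "'m \<Rightarrow> 'm \<Rightarrow> 'm \<Rightarrow> 'm \<Rightarrow> 'm"
  sigma :: "'m \<Rightarrow> 'm"
  pii :: "'m \<Rightarrow> 'm"

definition Pob :: "('o, 'm) cat \<Rightarrow> 'm wfs \<Rightarrow> 'm \<Rightarrow> 'o" where
  "Pob C W f = Dom C (rho W f)"

locale cloven_wfs = category C for C :: "('o, 'm) cat" (structure) +
  fixes W :: "'m wfs"
  assumes lam_hom: "f \<in> Arr C \<Longrightarrow> lam W f \<in> hom C (Dom C f) (Pob C W f)"
    and rho_hom: "f \<in> Arr C \<Longrightarrow> rho W f \<in> hom C (Pob C W f) (Cod C f)"
    and rho_lam: "f \<in> Arr C \<Longrightarrow> rho W f \<cdot> lam W f = f"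
    and Pm_hom: "square C f g h k \<Longrightarrow> Pm W f g h k \<in> hom C (Pob C W f) (Pob C W g)"
    and Pm_lam: "square C f g h k \<Longrightarrow> Pm W f g h k \<cdot> lam W f = lam W g \<cdot> h"
    and Pm_rho: "square C f g h k \<Longrightarrow> rho W g \<cdot> Pm W f g h k = k \<cdot> rho W f"
    and Pm_one: "f \<in> Arr C \<Longrightarrow>
          Pm W f f (One C (Dom C f)) (One C (Cod C f)) = One C (Pob C W f)"
    and Pm_comp: "square C f g h k \<Longrightarrow> square C g e h' k' \<Longrightarrow>
          Pm W f e (h' \<cdot> h) (k' \<cdot> k) = Pm W g e h' k' \<cdot> Pm W f g h k"
    and sigma_hom: "f \<in> Arr C \<Longrightarrow> sigma W f \<in> hom C (Pob C W f) (Pob C W (lam W f))"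
    and sigma_lam: "f \<in> Arr C \<Longrightarrow> sigma W f \<cdot> lam W f = lam W (lam W f)"
    and rho_sigma: "f \<in> Arr C \<Longrightarrow> rho W (lam W f) \<cdot> sigma W f = One C (Pob C W f)"
    and pii_hom: "f \<in> Arr C \<Longrightarrow> pii W f \<in> hom C (Pob C W (rho W f)) (Pob C W f)"
    and pii_lam: "f \<in> Arr C \<Longrightarrow> pii W f \<cdot> lam W (rho W f) = One C (Pob C W f)"
    and rho_pii: "f \<in> Arr C \<Longrightarrow> rho W f \<cdot> pii W f = rho W (rho W f)"

text \<open>A cloven map is a pair of the underlying arrow and its structure arrow.\<close>

definition L_map :: "('o, 'm) cat \<Rightarrow> 'm wfs \<Rightarrow> 'm \<times> 'm \<Rightarrow> bool" where
  "L_map C W = (\<lambda>(f, s). f \<in> Arr C \<and> s \<in> hom C (Cod C f) (Pob C W f) \<and>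
     s \<cdot>\<^bsub>C\<^esub> f = lam W f \<and> rho W f \<cdot>\<^bsub>C\<^esub> s = One C (Cod C f))"

definition R_map :: "('o, 'm) cat \<Rightarrow> 'm wfs \<Rightarrow> 'm \<times> 'm \<Rightarrow> bool" where
  "R_map C W = (\<lambda>(f, p). f \<in> Arr C \<and> p \<in> hom C (Pob C W f) (Dom C f) \<and>
     p \<cdot>\<^bsub>C\<^esub> lam W f = One C (Dom C f) \<and> f \<cdot>\<^bsub>C\<^esub> p = rho W f)"

definition L_mor :: "('o, 'm) cat \<Rightarrow> 'm wfs \<Rightarrow> 'm \<times> 'm \<Rightarrow> 'm \<times> 'm \<Rightarrow> 'm \<Rightarrow> 'm \<Rightarrow> bool" where
  "L_mor C W fs gt h k \<longleftrightarrow> L_map C W fs \<and> L_map C W gt \<and> square C (fst fs) (fst gt) h k \<and>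
     Pm W (fst fs) (fst gt) h k \<cdot>\<^bsub>C\<^esub> snd fs = snd gt \<cdot>\<^bsub>C\<^esub> k"

definition R_mor :: "('o, 'm) cat \<Rightarrow> 'm wfs \<Rightarrow> 'm \<times> 'm \<Rightarrow> 'm \<times> 'm \<Rightarrow> 'm \<Rightarrow> 'm \<Rightarrow> bool" where
  "R_mor C W fp gq h k \<longleftrightarrow> R_map C W fp \<and> R_map C W gq \<and> square C (fst fp) (fst gq) h k \<and>
     snd gq \<cdot>\<^bsub>C\<^esub> Pm W (fst fp) (fst gq) h k = h \<cdot>\<^bsub>C\<^esub> snd fp"


section \<open>Diagonal factorisations and the Frobenius property\<close>

text \<open>The fibre product of the domain of \<open>x\<close> with itself over the codomain is the chosen pullback
  \<open>pb x x\<close>.\<close>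

definition diagonal :: "('o, 'm) cat \<Rightarrow> ('m \<Rightarrow> 'm \<Rightarrow> 'm \<times> 'm) \<Rightarrow> 'm \<Rightarrow> 'm" where
  "diagonal C pb x =
     induced C (fst (pb x x)) (snd (pb x x)) (One C (Dom C x)) (One C (Dom C x))"

text \<open>The map \<open>f \<times>\<^sub>g f\<close>, for a square \<open>(f, g)\<close> from \<open>x\<close> to \<open>y\<close>.\<close>

definition fibre_prod_map ::
  "('o, 'm) cat \<Rightarrow> ('m \<Rightarrow> 'm \<Rightarrow> 'm \<times> 'm) \<Rightarrow> 'm \<Rightarrow> 'm \<Rightarrow> 'm \<Rightarrow> 'm" where
  "fibre_prod_map C pb x y f =
     induced C (fst (pb y y)) (snd (pb y y)) (f \<cdot>\<^bsub>C\<^esub> fst (pb x x)) (f \<cdot>\<^bsub>C\<^esub> snd (pb x x))"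

text \<open>\<open>Imap xp yq f g\<close> is \<open>I(f, g)\<close> for the morphism of cloven R-maps \<open>(f, g)\<close> from \<open>xp\<close> to \<open>yq\<close>.\<close>

record 'm diag =
  iL :: "'m \<times> 'm \<Rightarrow> 'm \<times> 'm"
  jR :: "'m \<times> 'm \<Rightarrow> 'm \<times> 'm"
  Imap :: "'m \<times> 'm \<Rightarrow> 'm \<times> 'm \<Rightarrow> 'm \<Rightarrow> 'm \<Rightarrow> 'm"

definition diagonal_factorisations ::
  "('o, 'm) cat \<Rightarrow> 'm wfs \<Rightarrow> ('m \<Rightarrow> 'm \<Rightarrow> 'm \<times> 'm) \<Rightarrow> 'm diag \<Rightarrow> bool" where
  "diagonal_factorisations C W pb D \<longleftrightarrow>
     (\<forall>xp. R_map C W xp \<longrightarrow>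
        L_map C W (iL D xp) \<and> R_map C W (jR D xp) \<and>
        Dom C (fst (iL D xp)) = Dom C (fst xp) \<and>
        Cod C (fst (iL D xp)) = Dom C (fst (jR D xp)) \<and>
        Cod C (fst (jR D xp)) = Dom C (fst (pb (fst xp) (fst xp))) \<and>
        fst (jR D xp) \<cdot>\<^bsub>C\<^esub> fst (iL D xp) = diagonal C pb (fst xp))"

definition functorial_diagonal ::
  "('o, 'm) cat \<Rightarrow> 'm wfs \<Rightarrow> ('m \<Rightarrow> 'm \<Rightarrow> 'm \<times> 'm) \<Rightarrow> 'm diag \<Rightarrow> bool" where
  "functorial_diagonal C W pb D \<longleftrightarrow>
     (\<forall>xp yq f g. R_mor C W xp yq f g \<longrightarrow>
        L_mor C W (iL D xp) (iL D yq) f (Imap D xp yq f g) \<and>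
        R_mor C W (jR D xp) (jR D yq) (Imap D xp yq f g)
          (fibre_prod_map C pb (fst xp) (fst yq) f)) \<and>
     (\<forall>xp. R_map C W xp \<longrightarrow>
        Imap D xp xp (One C (Dom C (fst xp))) (One C (Cod C (fst xp)))
          = One C (Dom C (fst (jR D xp)))) \<and>
     (\<forall>xp yq zr f g f' g'. R_mor C W xp yq f g \<and> R_mor C W yq zr f' g' \<longrightarrow>
        Imap D xp zr (f' \<cdot>\<^bsub>C\<^esub> f) (g' \<cdot>\<^bsub>C\<^esub> g) = Imap D yq zr f' g' \<cdot>\<^bsub>C\<^esub> Imap D xp yq f g)"

definition stable_diagonal ::
  "('o, 'm) cat \<Rightarrow> 'm wfs \<Rightarrow> ('m \<Rightarrow> 'm \<Rightarrow> 'm \<times> 'm) \<Rightarrow> 'm diag \<Rightarrow> bool" where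
  "stable_diagonal C W pb D \<longleftrightarrow>
     (\<forall>xp yq f g. R_mor C W xp yq f g \<and> pullback_square C (fst xp) (fst yq) f g \<longrightarrow>
        pullback_square C (fst (jR D xp)) (fst (jR D yq)) (Imap D xp yq f g)
          (fibre_prod_map C pb (fst xp) (fst yq) f))"

text \<open>\<open>Phi fp is ib fb\<close> is the structure assigned to \<open>ib\<close>, where \<open>(ib, fb)\<close> is a pullback of the
  cospan formed by the R-map \<open>fp\<close> and the L-map \<open>is\<close>.  The second clause is the action on morphisms
  of the functor into the category of cloven L-maps; preservation of identities and composites is
  then automatic, since a morphism of cloven L-maps is determined by its underlying square.\<close>

definition functorially_Frobenius ::
  "('o, 'm) cat \<Rightarrow> 'm wfs \<Rightarrow> ('m \<times> 'm \<Rightarrow> 'm \<times> 'm \<Rightarrow> 'm \<Rightarrow> 'm \<Rightarrow> 'm) \<Rightarrow> bool" where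
  "functorially_Frobenius C W Phi \<longleftrightarrow>
     (\<forall>fp is ib fb. R_map C W fp \<and> L_map C W is \<and> is_pullback C (fst fp) (fst is) ib fb \<longrightarrow>
        L_map C W (ib, Phi fp is ib fb)) \<and>
     (\<forall>fp is ib fb fp' is' ib' fb' b a x.
        is_pullback C (fst fp) (fst is) ib fb \<and> is_pullback C (fst fp') (fst is') ib' fb' \<and>
        R_mor C W fp fp' b a \<and> L_mor C W is is' x a \<longrightarrow>
        L_mor C W (ib, Phi fp is ib fb) (ib', Phi fp' is' ib' fb')
          (induced C ib' fb' (b \<cdot>\<^bsub>C\<^esub> ib) (x \<cdot>\<^bsub>C\<^esub> fb)) b)"


section \<open>Type categories\<close>

text \<open>\<open>Ext \<Gamma> A\<close> is \<open>\<Gamma>.A\<close> with projection \<open>Prj \<Gamma> A\<close>; \<open>Sub f A\<close> is \<open>A[f]\<close> and \<open>Lft f A\<close> is \<open>f\<^sup>+\<close>, where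
  \<open>A\<close> is a type over the codomain of \<open>f\<close>.\<close>

record ('o, 'm, 't) tcat =
  Cx :: "('o, 'm) cat"
  Ty :: "'o \<Rightarrow> 't set"
  Ext :: "'o \<Rightarrow> 't \<Rightarrow> 'o"
  Prj :: "'o \<Rightarrow> 't \<Rightarrow> 'm"
  Sub :: "'m \<Rightarrow> 't \<Rightarrow> 't"
  Lft :: "'m \<Rightarrow> 't \<Rightarrow> 'm"

locale type_category = category "Cx T" for T :: "('o, 'm, 't) tcat" +
  assumes Prj_hom: "\<Gamma> \<in> Ob (Cx T) \<Longrightarrow> A \<in> Ty T \<Gamma> \<Longrightarrow> Prj T \<Gamma> A \<in> hom (Cx T) (Ext T \<Gamma> A) \<Gamma>"
    and Sub_Ty: "f \<in> hom (Cx T) \<Delta> \<Gamma> \<Longrightarrow> A \<in> Ty T \<Gamma> \<Longrightarrow> Sub T f A \<in> Ty T \<Delta>"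
    and Lft_pullback: "f \<in> hom (Cx T) \<Delta> \<Gamma> \<Longrightarrow> A \<in> Ty T \<Gamma> \<Longrightarrow>
          pullback_square (Cx T) (Prj T \<Delta> (Sub T f A)) (Prj T \<Gamma> A) (Lft T f A) f"

definition wk :: "('o, 'm, 't) tcat \<Rightarrow> 'o \<Rightarrow> 't \<Rightarrow> 't" where
  "wk T \<Gamma> A = Sub T (Prj T \<Gamma> A) A"

text \<open>The context \<open>\<Gamma>.A.A\<^sup>+\<close>, the diagonal \<open>\<delta>\<^sub>A\<close> into it, and the map \<open>f\<^sup>+\<^sup>+\<close> from
  \<open>\<Delta>.A[f].A[f]\<^sup>+\<close> to \<open>\<Gamma>.A.A\<^sup>+\<close> induced by \<open>f\<^sup>+\<close>.\<close>

definition Ext2 :: "('o, 'm, 't) tcat \<Rightarrow> 'o \<Rightarrow> 't \<Rightarrow> 'o" where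
  "Ext2 T \<Gamma> A = Ext T (Ext T \<Gamma> A) (wk T \<Gamma> A)"

definition diag_ty :: "('o, 'm, 't) tcat \<Rightarrow> 'o \<Rightarrow> 't \<Rightarrow> 'm" where
  "diag_ty T \<Gamma> A =
     induced (Cx T) (Prj T (Ext T \<Gamma> A) (wk T \<Gamma> A)) (Lft T (Prj T \<Gamma> A) A)
       (One (Cx T) (Ext T \<Gamma> A)) (One (Cx T) (Ext T \<Gamma> A))"

definition Lft2 :: "('o, 'm, 't) tcat \<Rightarrow> 'o \<Rightarrow> 'o \<Rightarrow> 'm \<Rightarrow> 't \<Rightarrow> 'm" where
  "Lft2 T \<Delta> \<Gamma> f A =
     induced (Cx T) (Prj T (Ext T \<Gamma> A) (wk T \<Gamma> A)) (Lft T (Prj T \<Gamma> A) A)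
       (Lft T f A \<cdot>\<^bsub>Cx T\<^esub> Prj T (Ext T \<Delta> (Sub T f A)) (wk T \<Delta> (Sub T f A)))
       (Lft T f A \<cdot>\<^bsub>Cx T\<^esub> Lft T (Prj T \<Delta> (Sub T f A)) (Sub T f A))"

text \<open>Finite sequences of iterated types \<open>B\<^sub>1, \<dots>, B\<^sub>n\<close> over \<open>\<Gamma>\<close>: well-formedness, the extended
  context, its projection to \<open>\<Gamma>\<close>, substitution along \<open>g\<close>, and the map \<open>g\<^sup>+\<^sup>\<dots>\<^sup>+\<close> on the
  extended contexts.\<close>

primrec is_tel :: "('o, 'm, 't) tcat \<Rightarrow> 'o \<Rightarrow> 't list \<Rightarrow> bool" where
  "is_tel T \<Gamma> [] \<longleftrightarrow> True"
| "is_tel T \<Gamma> (B # Bs) \<longleftrightarrow> B \<in> Ty T \<Gamma> \<and> is_tel T (Ext T \<Gamma> B) Bs"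

primrec tel_Ext :: "('o, 'm, 't) tcat \<Rightarrow> 'o \<Rightarrow> 't list \<Rightarrow> 'o" where
  "tel_Ext T \<Gamma> [] = \<Gamma>"
| "tel_Ext T \<Gamma> (B # Bs) = tel_Ext T (Ext T \<Gamma> B) Bs"

primrec tel_Prj :: "('o, 'm, 't) tcat \<Rightarrow> 'o \<Rightarrow> 't list \<Rightarrow> 'm" where
  "tel_Prj T \<Gamma> [] = One (Cx T) \<Gamma>"
| "tel_Prj T \<Gamma> (B # Bs) = Prj T \<Gamma> B \<cdot>\<^bsub>Cx T\<^esub> tel_Prj T (Ext T \<Gamma> B) Bs"

primrec tel_Sub :: "('o, 'm, 't) tcat \<Rightarrow> 'm \<Rightarrow> 't list \<Rightarrow> 't list" where
  "tel_Sub T g [] = []"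
| "tel_Sub T g (B # Bs) = Sub T g B # tel_Sub T (Lft T g B) Bs"

primrec tel_Lft :: "('o, 'm, 't) tcat \<Rightarrow> 'm \<Rightarrow> 't list \<Rightarrow> 'm" where
  "tel_Lft T g [] = g"
| "tel_Lft T g (B # Bs) = tel_Lft T (Lft T g B) Bs"


section \<open>Strong identity types\<close>

record ('o, 'm, 't) idty =
  Idt :: "'o \<Rightarrow> 't \<Rightarrow> 't"
  refl_map :: "'o \<Rightarrow> 't \<Rightarrow> 'm"
  Jel :: "'o \<Rightarrow> 't \<Rightarrow> 't list \<Rightarrow> 't \<Rightarrow> 'm \<Rightarrow> 'm"

definition Ext3 :: "('o, 'm, 't) tcat \<Rightarrow> ('o, 'm, 't) idty \<Rightarrow> 'o \<Rightarrow> 't \<Rightarrow> 'o" where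
  "Ext3 T I \<Gamma> A = Ext T (Ext2 T \<Gamma> A) (Idt I \<Gamma> A)"

definition elim_data ::
  "('o, 'm, 't) tcat \<Rightarrow> ('o, 'm, 't) idty \<Rightarrow> 'o \<Rightarrow> 't \<Rightarrow> 't list \<Rightarrow> 't \<Rightarrow> 'm \<Rightarrow> bool" where
  "elim_data T I \<Gamma> A Bs K d \<longleftrightarrow>
     is_tel T (Ext3 T I \<Gamma> A) Bs \<and> K \<in> Ty T (tel_Ext T (Ext3 T I \<Gamma> A) Bs) \<and>
     d \<in> hom (Cx T) (tel_Ext T (Ext T \<Gamma> A) (tel_Sub T (refl_map I \<Gamma> A) Bs))
           (Ext T (tel_Ext T (Ext3 T I \<Gamma> A) Bs) K) \<and>
     Prj T (tel_Ext T (Ext3 T I \<Gamma> A) Bs) K \<cdot>\<^bsub>Cx T\<^esub> d = tel_Lft T (refl_map I \<Gamma> A) Bs"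

text \<open>Substitution of \<open>d\<close> along \<open>f\<close>, where \<open>\<theta>\<close> stands for \<open>f\<^sup>+\<^sup>+\<^sup>+\<close>.  The two squares
  with \<open>tel_Prj\<close> and \<open>tel_Lft (refl_map \<dots>)\<close> as sides are pullbacks, being composites of the defining
  pullbacks of substitution; \<open>base_map\<close> is the map from \<open>\<Delta>.A[f].Bs[\<theta>][r]\<close> to \<open>\<Gamma>.A.Bs[r]\<close> which
  \<open>f\<^sup>+\<close> and \<open>\<theta>\<close> induce between their vertices.\<close>

definition base_map ::
  "('o, 'm, 't) tcat \<Rightarrow> ('o, 'm, 't) idty \<Rightarrow> 'o \<Rightarrow> 'o \<Rightarrow> 'm \<Rightarrow> 't \<Rightarrow> 'm \<Rightarrow> 't list \<Rightarrow> 'm" where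
  "base_map T I \<Delta> \<Gamma> f A \<theta> Bs =
     (let A' = Sub T f A; Bs' = tel_Sub T \<theta> Bs; r = refl_map I \<Gamma> A; r' = refl_map I \<Delta> A' in
      induced (Cx T) (tel_Prj T (Ext T \<Gamma> A) (tel_Sub T r Bs)) (tel_Lft T r Bs)
        (Lft T f A \<cdot>\<^bsub>Cx T\<^esub> tel_Prj T (Ext T \<Delta> A') (tel_Sub T r' Bs'))
        (tel_Lft T \<theta> Bs \<cdot>\<^bsub>Cx T\<^esub> tel_Lft T r' Bs'))"

definition elim_sub ::
  "('o, 'm, 't) tcat \<Rightarrow> ('o, 'm, 't) idty \<Rightarrow> 'o \<Rightarrow> 'o \<Rightarrow> 'm \<Rightarrow> 't \<Rightarrow> 'm \<Rightarrow> 't list \<Rightarrow> 't \<Rightarrow> 'm \<Rightarrow> 'm"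
where
  "elim_sub T I \<Delta> \<Gamma> f A \<theta> Bs K d =
     (let A' = Sub T f A; Bs' = tel_Sub T \<theta> Bs; g = tel_Lft T \<theta> Bs in
      induced (Cx T) (Prj T (tel_Ext T (Ext3 T I \<Delta> A') Bs') (Sub T g K)) (Lft T g K)
        (tel_Lft T (refl_map I \<Delta> A') Bs')
        (d \<cdot>\<^bsub>Cx T\<^esub> base_map T I \<Delta> \<Gamma> f A \<theta> Bs))"

text \<open>Since substitution is not strictly functorial, \<open>Id[f\<^sup>+\<^sup>+]\<close> and the identity type of \<open>A[f]\<close>
  can only be compared up to isomorphism over \<open>\<Delta>.A[f].A[f]\<^sup>+\<close>.  Stability therefore provides
  \<open>\<theta> = f\<^sup>+\<^sup>+\<^sup>+\<close> over \<open>f\<^sup>+\<^sup>+\<close> making a pullback square, i.e. with invertible comparison map.  As the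
  fillers are sections, the last equation says exactly that the filler for the substituted data is
  the substitution of the given filler.\<close>

locale strong_identity_types = type_category T for T :: "('o, 'm, 't) tcat" +
  fixes I :: "('o, 'm, 't) idty"
  assumes Idt_Ty: "\<Gamma> \<in> Ob (Cx T) \<Longrightarrow> A \<in> Ty T \<Gamma> \<Longrightarrow> Idt I \<Gamma> A \<in> Ty T (Ext2 T \<Gamma> A)"
    and refl_hom: "\<Gamma> \<in> Ob (Cx T) \<Longrightarrow> A \<in> Ty T \<Gamma> \<Longrightarrow>
          refl_map I \<Gamma> A \<in> hom (Cx T) (Ext T \<Gamma> A) (Ext3 T I \<Gamma> A)"
    and refl_diag: "\<Gamma> \<in> Ob (Cx T) \<Longrightarrow> A \<in> Ty T \<Gamma> \<Longrightarrow>
          Prj T (Ext2 T \<Gamma> A) (Idt I \<Gamma> A) \<cdot>\<^bsub>Cx T\<^esub> refl_map I \<Gamma> A = diag_ty T \<Gamma> A"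
    and Jel_hom: "\<Gamma> \<in> Ob (Cx T) \<Longrightarrow> A \<in> Ty T \<Gamma> \<Longrightarrow> elim_data T I \<Gamma> A Bs K d \<Longrightarrow>
          Jel I \<Gamma> A Bs K d \<in> hom (Cx T) (tel_Ext T (Ext3 T I \<Gamma> A) Bs)
            (Ext T (tel_Ext T (Ext3 T I \<Gamma> A) Bs) K)"
    and Jel_refl: "\<Gamma> \<in> Ob (Cx T) \<Longrightarrow> A \<in> Ty T \<Gamma> \<Longrightarrow> elim_data T I \<Gamma> A Bs K d \<Longrightarrow>
          Jel I \<Gamma> A Bs K d \<cdot>\<^bsub>Cx T\<^esub> tel_Lft T (refl_map I \<Gamma> A) Bs = d"
    and Jel_section: "\<Gamma> \<in> Ob (Cx T) \<Longrightarrow> A \<in> Ty T \<Gamma> \<Longrightarrow> elim_data T I \<Gamma> A Bs K d \<Longrightarrow>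
          Prj T (tel_Ext T (Ext3 T I \<Gamma> A) Bs) K \<cdot>\<^bsub>Cx T\<^esub> Jel I \<Gamma> A Bs K d
            = One (Cx T) (tel_Ext T (Ext3 T I \<Gamma> A) Bs)"
    and substitution: "f \<in> hom (Cx T) \<Delta> \<Gamma> \<Longrightarrow> A \<in> Ty T \<Gamma> \<Longrightarrow>
          \<exists>\<theta>. pullback_square (Cx T)
                (Prj T (Ext2 T \<Delta> (Sub T f A)) (Idt I \<Delta> (Sub T f A)))
                (Prj T (Ext2 T \<Gamma> A) (Idt I \<Gamma> A)) \<theta> (Lft2 T \<Delta> \<Gamma> f A) \<and>
              \<theta> \<cdot>\<^bsub>Cx T\<^esub> refl_map I \<Delta> (Sub T f A) = refl_map I \<Gamma> A \<cdot>\<^bsub>Cx T\<^esub> Lft T f A \<and>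
              (\<forall>Bs K d. elim_data T I \<Gamma> A Bs K d \<longrightarrow>
                 Lft T (tel_Lft T \<theta> Bs) K \<cdot>\<^bsub>Cx T\<^esub>
                   Jel I \<Delta> (Sub T f A) (tel_Sub T \<theta> Bs) (Sub T (tel_Lft T \<theta> Bs) K)
                     (elim_sub T I \<Delta> \<Gamma> f A \<theta> Bs K d)
                 = Jel I \<Gamma> A Bs K d \<cdot>\<^bsub>Cx T\<^esub> tel_Lft T \<theta> Bs)"

definition categorical_model :: "('o, 'm, 't) tcat \<Rightarrow> bool" where
  "categorical_model T \<longleftrightarrow> type_category T \<and> (\<exists>I. strong_identity_types T I)"


section \<open>The type category of cloven R-maps\<close>

text \<open>The induced structure \<open>p'\<close> on the pullback \<open>x'\<close> of \<open>(x, p)\<close> along \<open>f\<close> is the unique one with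
  \<open>x' p' = \<rho>\<^bsub>x'\<^esub>\<close> and \<open>f\<^sup>+ p' = p P(f\<^sup>+, f)\<close>, i.e. making the pullback square a morphism of
  cloven R-maps.\<close>

definition R_pullback ::
  "('o, 'm) cat \<Rightarrow> 'm wfs \<Rightarrow> ('m \<Rightarrow> 'm \<Rightarrow> 'm \<times> 'm) \<Rightarrow> 'm \<Rightarrow> 'm \<times> 'm \<Rightarrow> 'm \<times> 'm" where
  "R_pullback C W pb f = (\<lambda>(x, p). case pb f x of (x', f') \<Rightarrow>
     (x', induced C x' f' (rho W x') (p \<cdot>\<^bsub>C\<^esub> Pm W x' x f' f)))"

definition R_type_category ::
  "('o, 'm) cat \<Rightarrow> 'm wfs \<Rightarrow> ('m \<Rightarrow> 'm \<Rightarrow> 'm \<times> 'm) \<Rightarrow> ('o, 'm, 'm \<times> 'm) tcat" where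
  "R_type_category C W pb =
     \<lparr> Cx = C,
       Ty = (\<lambda>\<Gamma>. {xp. R_map C W xp \<and> Cod C (fst xp) = \<Gamma>}),
       Ext = (\<lambda>\<Gamma> xp. Dom C (fst xp)),
       Prj = (\<lambda>\<Gamma> xp. fst xp),
       Sub = R_pullback C W pb,
       Lft = (\<lambda>f xp. snd (pb f (fst xp))) \<rparr>"

end

(* The reflexivity map of A is a cloven L-map.  Iterating the Frobenius property transports this
   structure along every telescope, and the filler against a cloven R-map q is the canonical
   diagonal q P(d, 1) s.  Stability under substitution is the naturality of these canonical
   diagonals in morphisms of cloven L- and R-maps. *)
theory Submission
  imports Defs
begin

section \<open>Composition, uniqueness and pasting for pullbacks in an arbitrary category\<close>

section \<open>Pullbacks\<close>

context category
begin

lemma comp_arr: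
  assumes "f \<in> Arr C" "g \<in> Arr C" "Cod C f = Dom C g"
  shows "g \<cdot> f \<in> Arr C" "Dom C (g \<cdot> f) = Dom C f" "Cod C (g \<cdot> f) = Cod C g"
  using comp_hom[of f "Dom C f" "Dom C g" g "Cod C g"] assms by (auto simp: hom_def)

lemma comp_assoc:
  assumes "f \<in> Arr C" "g \<in> Arr C" "h \<in> Arr C" "Cod C f = Dom C g" "Cod C g = Dom C h"
  shows "(h \<cdot> g) \<cdot> f = h \<cdot> (g \<cdot> f)"
  by (rule assoc[of f "Dom C f" "Dom C g" g "Dom C h" h "Cod C h"]) (use assms in \<open>auto simp: hom_def\<close>)

lemma one_arr:
  assumes "a \<in> Ob C"
  shows "One C a \<in> Arr C" "Dom C (One C a) = a" "Cod C (One C a) = a"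
  using one_hom[OF assms] by (auto simp: hom_def)

lemma dom_ob: "f \<in> Arr C \<Longrightarrow> Dom C f \<in> Ob C"
  and cod_ob: "f \<in> Arr C \<Longrightarrow> Cod C f \<in> Ob C"
  using dom_cod by blast+

lemma one_comp: "f \<in> Arr C \<Longrightarrow> Cod C f = b \<Longrightarrow> One C b \<cdot> f = f"
  by (rule one_left) (auto simp: hom_def)

lemma comp_one: "f \<in> Arr C \<Longrightarrow> Dom C f = a \<Longrightarrow> f \<cdot> One C a = f"
  by (rule one_right) (auto simp: hom_def)

lemmas cat_simps = comp_arr comp_assoc one_arr dom_ob cod_ob one_comp comp_one

text \<open>Precomposes a commuting square with \<open>z\<close> while keeping both sides nested to
  the right. Rewriting with associativity hides the factor \<open>g \<cdot> f\<close>, so the square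
  could not be applied directly.\<close>

lemma comp_eq_comp:
  assumes "g \<cdot> f = g' \<cdot> f'" "z \<in> Arr C" "f \<in> Arr C" "g \<in> Arr C" "f' \<in> Arr C" "g' \<in> Arr C"
    "Cod C z = Dom C f" "Cod C f = Dom C g" "Cod C z = Dom C f'" "Cod C f' = Dom C g'"
  shows "g \<cdot> (f \<cdot> z) = g' \<cdot> (f' \<cdot> z)"
  using assms by (metis comp_assoc)

lemma pullbackD:
  assumes "is_pullback C f g p q"
  shows "f \<in> Arr C" "g \<in> Arr C" "p \<in> Arr C" "q \<in> Arr C" "Cod C f = Cod C g"
    "Dom C p = Dom C q" "Cod C p = Dom C f" "Cod C q = Dom C g" "f \<cdot> p = g \<cdot> q"
  using assms unfolding is_pullback_def by blast+

lemma pullback_ex1: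
  assumes "is_pullback C f g p q" "u \<in> hom C a (Dom C f)" "v \<in> hom C a (Dom C g)" "f \<cdot> u = g \<cdot> v"
  shows "\<exists>!w. w \<in> hom C a (Dom C p) \<and> p \<cdot> w = u \<and> q \<cdot> w = v"
  using assms unfolding is_pullback_def by blast

text \<open>The projections are jointly monic: \<open>w\<close> and \<open>w'\<close> both mediate
  for the cone \<open>(p \<cdot> w, q \<cdot> w)\<close>.\<close>

lemma pullback_unique:
  assumes pb: "is_pullback C f g p q"
    and w: "w \<in> hom C a (Dom C p)" and w': "w' \<in> hom C a (Dom C p)"
    and "p \<cdot> w = p \<cdot> w'" "q \<cdot> w = q \<cdot> w'"
  shows "w = w'"
proof -
  note P = pullbackD[OF pb]
  have "p \<cdot> w \<in> hom C a (Dom C f)" "q \<cdot> w \<in> hom C a (Dom C g)"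
    using P w by (auto simp: hom_def cat_simps)
  moreover have "f \<cdot> (p \<cdot> w) = g \<cdot> (q \<cdot> w)"
    using P w by (intro comp_eq_comp) (auto simp: hom_def)
  ultimately show ?thesis
    using pullback_ex1[OF pb] assms by (metis (no_types, lifting))
qed

lemma pullback_induced:
  assumes pb: "is_pullback C f g p q"
    and "u \<in> Arr C" "v \<in> Arr C" "Dom C u = Dom C v" "Cod C u = Dom C f" "Cod C v = Dom C g"
    and "f \<cdot> u = g \<cdot> v"
  shows "induced C p q u v \<in> Arr C" "Dom C (induced C p q u v) = Dom C u"
    "Cod C (induced C p q u v) = Dom C p"
    "p \<cdot> induced C p q u v = u" "q \<cdot> induced C p q u v = v"
proof -
  have "\<exists>!w. w \<in> hom C (Dom C u) (Dom C p) \<and> p \<cdot> w = u \<and> q \<cdot> w = v"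
    by (rule pullback_ex1[OF pb]) (use assms in \<open>auto simp: hom_def\<close>)
  from theI'[OF this] show "induced C p q u v \<in> Arr C" "Dom C (induced C p q u v) = Dom C u"
    "Cod C (induced C p q u v) = Dom C p"
    "p \<cdot> induced C p q u v = u" "q \<cdot> induced C p q u v = v"
    unfolding induced_def[symmetric] by (auto simp: hom_def)
qed

lemma induced_eqI:
  assumes pb: "is_pullback C f g p q" and "w \<in> hom C (Dom C u) (Dom C p)"
    and "p \<cdot> w = u" "q \<cdot> w = v"
  shows "induced C p q u v = w"
  unfolding induced_def
  by (rule the_equality) (use assms in \<open>auto intro: pullback_unique[OF pb]\<close>)

lemma pullback_sym:
  assumes "is_pullback C f g p q"
  shows "is_pullback C g f q p"
  unfolding is_pullback_def
proof (intro conjI allI ballI impI)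
  fix a u v assume "u \<in> hom C a (Dom C g)" "v \<in> hom C a (Dom C f)" "g \<cdot> u = f \<cdot> v"
  then have "\<exists>!w. w \<in> hom C a (Dom C p) \<and> p \<cdot> w = v \<and> q \<cdot> w = u"
    by (intro pullback_ex1[OF assms]) auto
  then show "\<exists>!w. w \<in> hom C a (Dom C q) \<and> q \<cdot> w = u \<and> p \<cdot> w = v"
    unfolding pullbackD(6)[OF assms] by metis
qed (use pullbackD[OF assms] in auto)

text \<open>The degenerate pullback that belongs to the empty telescope, whose projection is an
  identity and whose lift is \<open>g\<close> itself.\<close>

lemma pullback_one:
  assumes "g \<in> Arr C"
  shows "is_pullback C g (One C (Cod C g)) (One C (Dom C g)) g"
  unfolding is_pullback_def using assms
  by (auto simp: cat_simps hom_def)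

text \<open>A cone on the outer rectangle factors first through \<open>A\<close>, with
  \<open>y \<cdot> t\<close> as second leg, and the resulting \<open>r\<close> then factors through
  \<open>B\<close>. The orientation follows the recursion of \<open>tel_Prj\<close>, which composes
  one projection with that of the remaining telescope.\<close>

lemma pullback_paste:
  assumes A: "is_pullback C i x u j" and B: "is_pullback C j y v w"
  shows "is_pullback C i (x \<cdot> y) (u \<cdot> v) w"
proof -
  note PA = pullbackD[OF A] and PB = pullbackD[OF B]
  have "i \<cdot> (u \<cdot> v) = x \<cdot> (j \<cdot> v)" using PA PB by (intro comp_eq_comp) auto
  then have eq: "i \<cdot> (u \<cdot> v) = (x \<cdot> y) \<cdot> w" using PA PB by (simp add: comp_assoc)
  have "\<exists>!z. z \<in> hom C a (Dom C (u \<cdot> v)) \<and> (u \<cdot> v) \<cdot> z = s \<and> w \<cdot> z = t"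
    if s: "s \<in> hom C a (Dom C i)" and t: "t \<in> hom C a (Dom C (x \<cdot> y))" and st: "i \<cdot> s = (x \<cdot> y) \<cdot> t"
    for a s t
  proof -
    note S = s[unfolded hom_def, simplified] and T = t[unfolded hom_def, simplified]
    have dxy: "Dom C (x \<cdot> y) = Dom C y" "Dom C (u \<cdot> v) = Dom C v" using PA PB by (simp_all add: cat_simps)
    have yt: "y \<cdot> t \<in> hom C a (Dom C x)" using PA PB T dxy by (simp add: hom_def cat_simps)
    have "i \<cdot> s = x \<cdot> (y \<cdot> t)" using st PA PB T dxy by (simp add: comp_assoc)
    from pullback_ex1[OF A s yt this] obtain r
      where r: "r \<in> hom C a (Dom C u)" "u \<cdot> r = s" "j \<cdot> r = y \<cdot> t" by blast
    have "r \<in> hom C a (Dom C j)" "t \<in> hom C a (Dom C y)" using r t PA dxy by auto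
    from pullback_ex1[OF B this r(3)] obtain z
      where z: "z \<in> hom C a (Dom C v)" "v \<cdot> z = r" "w \<cdot> z = t" by blast
    show ?thesis
    proof (rule ex1I[of _ z])
      show "z \<in> hom C a (Dom C (u \<cdot> v)) \<and> (u \<cdot> v) \<cdot> z = s \<and> w \<cdot> z = t"
        using z r dxy PA PB by (auto simp: hom_def comp_assoc)
    next
      fix z' assume z': "z' \<in> hom C a (Dom C (u \<cdot> v)) \<and> (u \<cdot> v) \<cdot> z' = s \<and> w \<cdot> z' = t"
      then have h: "z' \<in> hom C a (Dom C v)" using dxy by simp
      \<comment> \<open>Uniqueness needs both squares in turn: agreement after \<open>v\<close>
        comes from \<open>A\<close>, and only then does \<open>B\<close> identify \<open>z'\<close>
        with \<open>z\<close>.\<close>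
      have "v \<cdot> z' = v \<cdot> z"
      proof (rule pullback_unique[OF A])
        show "v \<cdot> z' \<in> hom C a (Dom C u)" "v \<cdot> z \<in> hom C a (Dom C u)"
          using h z PA PB by (auto simp: hom_def cat_simps)
        show "u \<cdot> (v \<cdot> z') = u \<cdot> (v \<cdot> z)"
          using z' h z r PA PB by (auto simp: hom_def comp_assoc)
        have "j \<cdot> (v \<cdot> z') = y \<cdot> (w \<cdot> z')"
          using h PB by (intro comp_eq_comp) (auto simp: hom_def)
        also have "\<dots> = j \<cdot> (v \<cdot> z)" using z' z r by simp
        finally show "j \<cdot> (v \<cdot> z') = j \<cdot> (v \<cdot> z)" .
      qed
      then show "z' = z" using pullback_unique[OF B h z(1)] z z' by simp
    qed
  qed
  then show ?thesis
    unfolding is_pullback_def using eq PA PB by (simp add: cat_simps)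
qed

lemma squareD:
  assumes "square C f g h k"
  shows "f \<in> Arr C" "g \<in> Arr C" "h \<in> Arr C" "k \<in> Arr C" "Dom C h = Dom C f" "Cod C h = Dom C g"
    "Dom C k = Cod C f" "Cod C k = Cod C g" "g \<cdot> h = k \<cdot> f"
  using assms by (auto simp: square_def hom_def)

lemma squareI:
  assumes "f \<in> Arr C" "g \<in> Arr C" "h \<in> Arr C" "k \<in> Arr C" "Dom C h = Dom C f" "Cod C h = Dom C g"
    "Dom C k = Cod C f" "Cod C k = Cod C g" "g \<cdot> h = k \<cdot> f"
  shows "square C f g h k"
  using assms by (auto simp: square_def hom_def)

end

section \<open>Substitution into iterated types as an iterated pullback\<close>

section \<open>Telescopes\<close>

context type_category
begin

lemma Lft_is_pullback:
  assumes "f \<in> hom (Cx T) \<Delta> \<Gamma>" "A \<in> Ty T \<Gamma>"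
  shows "is_pullback (Cx T) f (Prj T \<Gamma> A) (Prj T \<Delta> (Sub T f A)) (Lft T f A)"
  using Lft_pullback[OF assms] by (simp add: pullback_square_def)

lemma Lft_hom:
  assumes f: "f \<in> hom (Cx T) \<Delta> \<Gamma>" and A: "A \<in> Ty T \<Gamma>"
  shows "Lft T f A \<in> hom (Cx T) (Ext T \<Delta> (Sub T f A)) (Ext T \<Gamma> A)"
proof -
  have "\<Gamma> \<in> Ob (Cx T)" "\<Delta> \<in> Ob (Cx T)" using f dom_cod by (auto simp: hom_def)
  then show ?thesis
    using pullbackD[OF Lft_is_pullback[OF f A]] Prj_hom A Sub_Ty[OF f A] by (auto simp: hom_def)
qed

lemma is_tel_tel_Sub:
  assumes "g \<in> hom (Cx T) \<Delta> \<Gamma>" "is_tel T \<Gamma> Bs"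
  shows "is_tel T \<Delta> (tel_Sub T g Bs)"
  using assms by (induction Bs arbitrary: g \<Delta> \<Gamma>) (auto intro: Sub_Ty Lft_hom)

text \<open>Each type contributes one defining pullback of substitution, and these are pasted along
  the telescope. This is what gives the \<open>induced\<close> in \<open>base_map\<close> its
  meaning.\<close>

lemma tel_pullback:
  assumes "g \<in> hom (Cx T) \<Delta> \<Gamma>" "is_tel T \<Gamma> Bs"
  shows "is_pullback (Cx T) g (tel_Prj T \<Gamma> Bs) (tel_Prj T \<Delta> (tel_Sub T g Bs)) (tel_Lft T g Bs)"
  using assms
proof (induction Bs arbitrary: g \<Delta> \<Gamma>)
  case Nil
  then show ?case using pullback_one[of g] by (auto simp: hom_def)
next
  case (Cons B Bs)
  then show ?case by (auto intro!: pullback_paste[OF Lft_is_pullback] Lft_hom)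
qed

lemma tel_Lft_hom:
  assumes "g \<in> hom (Cx T) \<Delta> \<Gamma>" "is_tel T \<Gamma> Bs"
  shows "tel_Lft T g Bs \<in> hom (Cx T) (tel_Ext T \<Delta> (tel_Sub T g Bs)) (tel_Ext T \<Gamma> Bs)"
  using assms by (induction Bs arbitrary: g \<Delta> \<Gamma>) (auto intro: Lft_hom)

end

section \<open>Diagonal fillers of L-maps against R-maps and their naturality\<close>

section \<open>Canonical fillers\<close>

text \<open>The diagonal determined by the two structures: from the codomain of the L-map by its
  section into the factorisation object, across by \<open>P(h, k)\<close>, and down by the
  R-structure. Being an explicit composite, it is natural in both arguments.\<close>

definition lift :: "('o, 'm) cat \<Rightarrow> 'm wfs \<Rightarrow> 'm \<times> 'm \<Rightarrow> 'm \<times> 'm \<Rightarrow> 'm \<Rightarrow> 'm \<Rightarrow> 'm" where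
  "lift C W is xp h k = snd xp \<cdot>\<^bsub>C\<^esub> (Pm W (fst is) (fst xp) h k \<cdot>\<^bsub>C\<^esub> snd is)"

context cloven_wfs
begin

lemma lam_arr:
  assumes "f \<in> Arr C"
  shows "lam W f \<in> Arr C" "Dom C (lam W f) = Dom C f" "Cod C (lam W f) = Pob C W f"
  using lam_hom[OF assms] by (auto simp: hom_def)

lemma rho_arr:
  assumes "f \<in> Arr C"
  shows "rho W f \<in> Arr C" "Dom C (rho W f) = Pob C W f" "Cod C (rho W f) = Cod C f"
  using rho_hom[OF assms] by (auto simp: hom_def)

lemma Pm_arr:
  assumes "square C f g h k"
  shows "Pm W f g h k \<in> Arr C" "Dom C (Pm W f g h k) = Pob C W f" "Cod C (Pm W f g h k) = Pob C W g"
  using Pm_hom[OF assms] by (auto simp: hom_def)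

lemma L_mapD:
  assumes "L_map C W fs"
  shows "fst fs \<in> Arr C" "snd fs \<in> Arr C" "Dom C (snd fs) = Cod C (fst fs)"
    "Cod C (snd fs) = Pob C W (fst fs)" "snd fs \<cdot> fst fs = lam W (fst fs)"
    "rho W (fst fs) \<cdot> snd fs = One C (Cod C (fst fs))"
  using assms by (auto simp: L_map_def hom_def split: prod.splits)

lemma R_mapD:
  assumes "R_map C W fp"
  shows "fst fp \<in> Arr C" "snd fp \<in> Arr C" "Dom C (snd fp) = Pob C W (fst fp)"
    "Cod C (snd fp) = Dom C (fst fp)" "snd fp \<cdot> lam W (fst fp) = One C (Dom C (fst fp))"
    "fst fp \<cdot> snd fp = rho W (fst fp)"
  using assms by (auto simp: R_map_def hom_def split: prod.splits)

lemma lift_arr: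
  assumes L: "L_map C W is" and R: "R_map C W xp" and sq: "square C (fst is) (fst xp) h k"
  shows "lift C W is xp h k \<in> Arr C" "Dom C (lift C W is xp h k) = Cod C (fst is)"
    "Cod C (lift C W is xp h k) = Dom C (fst xp)"
  using L_mapD[OF L] R_mapD[OF R] Pm_arr[OF sq] by (simp_all add: lift_def cat_simps)

text \<open>The section turns \<open>fst is\<close> into its \<open>lam\<close>, naturality of
  \<open>lam\<close> moves this past \<open>P(h, k)\<close>, and the R-structure cancels the
  \<open>lam\<close> of the R-map.\<close>

lemma lift_upper:
  assumes L: "L_map C W is" and R: "R_map C W xp" and sq: "square C (fst is) (fst xp) h k"
  shows "lift C W is xp h k \<cdot> fst is = h"
proof -
  note simps = L_mapD[OF L] R_mapD[OF R] Pm_arr[OF sq] squareD[OF sq] lam_arr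
  have "lift C W is xp h k \<cdot> fst is = snd xp \<cdot> (Pm W (fst is) (fst xp) h k \<cdot> lam W (fst is))"
    using simps by (simp add: lift_def cat_simps)
  also have "\<dots> = (snd xp \<cdot> lam W (fst xp)) \<cdot> h"
    unfolding Pm_lam[OF sq] by (rule comp_assoc[symmetric]) (use simps in auto)
  also have "\<dots> = h" using simps by (simp add: cat_simps)
  finally show ?thesis .
qed

text \<open>Dual to the upper triangle: the R-map composed with its structure is \<open>rho\<close>,
  which is natural, and \<open>rho\<close> cancels the section of the L-map.\<close>

lemma lift_lower:
  assumes L: "L_map C W is" and R: "R_map C W xp" and sq: "square C (fst is) (fst xp) h k"
  shows "fst xp \<cdot> lift C W is xp h k = k"
proof -
  note simps = L_mapD[OF L] R_mapD[OF R] Pm_arr[OF sq] squareD[OF sq] rho_arr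
  have "fst xp \<cdot> lift C W is xp h k = (fst xp \<cdot> snd xp) \<cdot> (Pm W (fst is) (fst xp) h k \<cdot> snd is)"
    unfolding lift_def by (rule comp_assoc[symmetric]) (use simps in \<open>auto simp: comp_arr\<close>)
  also have "\<dots> = rho W (fst xp) \<cdot> (Pm W (fst is) (fst xp) h k \<cdot> snd is)"
    using simps by simp
  also have "\<dots> = k \<cdot> (rho W (fst is) \<cdot> snd is)"
    by (rule comp_eq_comp) (use simps Pm_rho[OF sq] in auto)
  also have "\<dots> = k" using simps by (simp add: cat_simps)
  finally show ?thesis .
qed

text \<open>The morphism law replaces \<open>snd is \<cdot> g\<close> by \<open>P(b, g)\<close>
  after the other section, and functoriality of \<open>P\<close> merges the two squares.\<close>

lemma lift_L_mor:
  assumes m: "L_mor C W is' is b g" and R: "R_map C W xp" and sq: "square C (fst is) (fst xp) h k"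
  shows "lift C W is xp h k \<cdot> g = lift C W is' xp (h \<cdot> b) (k \<cdot> g)"
proof -
  have m': "L_map C W is'" "L_map C W is" "square C (fst is') (fst is) b g"
    "Pm W (fst is') (fst is) b g \<cdot> snd is' = snd is \<cdot> g"
    using m by (auto simp: L_mor_def)
  note simps = L_mapD[OF m'(1)] L_mapD[OF m'(2)] R_mapD[OF R] Pm_arr[OF sq] squareD[OF sq]
    squareD[OF m'(3)] Pm_arr[OF m'(3)]
  show ?thesis
    using simps m'(4) by (simp add: lift_def Pm_comp[OF m'(3) sq] comp_assoc comp_arr)
qed

text \<open>The dual naturality: the law for R-morphisms trades \<open>b \<cdot> snd xp\<close> for
  the other structure after \<open>P(b, g)\<close>, which again merges with
  \<open>P(h, k)\<close>.\<close>

lemma lift_R_mor: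
  assumes m: "R_mor C W xp yq b g" and L: "L_map C W is" and sq: "square C (fst is) (fst xp) h k"
  shows "b \<cdot> lift C W is xp h k = lift C W is yq (b \<cdot> h) (g \<cdot> k)"
proof -
  have m': "R_map C W xp" "R_map C W yq" "square C (fst xp) (fst yq) b g"
    "snd yq \<cdot> Pm W (fst xp) (fst yq) b g = b \<cdot> snd xp"
    using m by (auto simp: R_mor_def)
  note simps = L_mapD[OF L] R_mapD[OF m'(1)] R_mapD[OF m'(2)] Pm_arr[OF sq] squareD[OF sq]
    squareD[OF m'(3)] Pm_arr[OF m'(3)]
  have "b \<cdot> lift C W is xp h k = (b \<cdot> snd xp) \<cdot> (Pm W (fst is) (fst xp) h k \<cdot> snd is)"
    using simps by (simp add: lift_def cat_simps)
  also have "\<dots> = lift C W is yq (b \<cdot> h) (g \<cdot> k)"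
    unfolding m'(4)[symmetric] using simps by (simp add: lift_def Pm_comp[OF sq m'(3)] cat_simps)
  finally show ?thesis .
qed

end

section \<open>Cloven R-maps are closed under pullback and form a type category\<close>

section \<open>The type category of cloven R-maps\<close>

locale R_types = cloven_wfs +
  fixes pb :: "'b \<Rightarrow> 'b \<Rightarrow> 'b \<times> 'b"
  assumes pb_choice: "pullback_choice C pb"
begin

abbreviation T :: "('a, 'b, 'b \<times> 'b) tcat" where
  "T \<equiv> R_type_category C W pb"

lemma T_simps [simp]:
  "Cx T = C" "Ext T \<Gamma> A = Dom C (fst A)" "Prj T \<Gamma> A = fst A" "Sub T = R_pullback C W pb"
  "Lft T f A = snd (pb f (fst A))" "A \<in> Ty T \<Gamma> \<longleftrightarrow> R_map C W A \<and> Cod C (fst A) = \<Gamma>"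
  by (simp_all add: R_type_category_def)

lemma pb_pullback:
  assumes "f \<in> Arr C" "g \<in> Arr C" "Cod C f = Cod C g"
  shows "is_pullback C f g (fst (pb f g)) (snd (pb f g))"
  using pb_choice assms by (simp add: pullback_choice_def)

lemma fst_R_pullback [simp]: "fst (R_pullback C W pb f A) = fst (pb f (fst A))"
  by (simp add: R_pullback_def split: prod.splits)

text \<open>The induced structure is a map into a pullback, so its laws can be tested on the two
  projections. One component is the law over the base, and the other is literally the condition for
  a morphism of R-maps.\<close>

lemma R_pullback_mor:
  assumes f: "f \<in> Arr C" and A: "R_map C W A" "Cod C (fst A) = Cod C f"
  shows "R_mor C W (R_pullback C W pb f A) A (snd (pb f (fst A))) f"
proof -
  obtain x p where [simp]: "A = (x, p)" by (cases A)
  obtain x' f' where eq: "pb f x = (x', f')" by (cases "pb f x")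
  note RA = R_mapD[OF A(1), simplified]
  have pull: "is_pullback C f x x' f'" using pb_pullback[OF f, of x] RA A eq by simp
  note P = pullbackD[OF pull]
  have sq: "square C x' x f' f" using P by (intro squareI) auto
  let ?P = "Pm W x' x f' f" and ?p' = "induced C x' f' (rho W x') (p \<cdot> Pm W x' x f' f)"
  note simps = RA P Pm_arr[OF sq] rho_arr lam_arr
  \<comment> \<open>The two legs form a cone, by naturality of \<open>rho\<close> and
    \<open>x \<cdot> p = rho W x\<close>; without this \<open>induced\<close> would carry no
    information.\<close>
  have "f \<cdot> rho W x' = x \<cdot> (p \<cdot> ?P)"
  proof -
    have "f \<cdot> rho W x' = (x \<cdot> p) \<cdot> ?P" using RA Pm_rho[OF sq] by simp
    also have "\<dots> = x \<cdot> (p \<cdot> ?P)" by (rule comp_assoc) (use simps in auto)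
    finally show ?thesis .
  qed
  with simps have p': "?p' \<in> Arr C" "Dom C ?p' = Pob C W x'" "Cod C ?p' = Dom C x'"
    "x' \<cdot> ?p' = rho W x'" "f' \<cdot> ?p' = p \<cdot> ?P"
    using pullback_induced[OF pull, of "rho W x'" "p \<cdot> ?P"] by (auto simp: comp_arr)
  \<comment> \<open>Over the base this is the factorisation \<open>rho \<cdot> lam = x'\<close>; on
    the other projection it reduces, by naturality of \<open>lam\<close>, to the same law for
    \<open>p\<close>.\<close>
  have "?p' \<cdot> lam W x' = One C (Dom C x')"
  proof (rule pullback_unique[OF pull])
    show "?p' \<cdot> lam W x' \<in> hom C (Dom C x') (Dom C x')" "One C (Dom C x') \<in> hom C (Dom C x') (Dom C x')"
      using p' simps by (simp_all add: hom_def cat_simps)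
    have "x' \<cdot> (?p' \<cdot> lam W x') = (x' \<cdot> ?p') \<cdot> lam W x'"
      using p'(1-3) simps by (simp only: comp_assoc)
    then show "x' \<cdot> (?p' \<cdot> lam W x') = x' \<cdot> One C (Dom C x')"
      using p'(4) P by (simp add: rho_lam cat_simps)
    have "f' \<cdot> (?p' \<cdot> lam W x') = (f' \<cdot> ?p') \<cdot> lam W x'"
      using p'(1-3) simps by (simp only: comp_assoc)
    also have "\<dots> = p \<cdot> (?P \<cdot> lam W x')"
      unfolding p'(5) using simps by (simp add: comp_assoc)
    also have "\<dots> = (p \<cdot> lam W x) \<cdot> f'"
      unfolding Pm_lam[OF sq] using simps by (subst comp_assoc) auto
    also have "\<dots> = f' \<cdot> One C (Dom C x')" using simps by (simp add: cat_simps)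
    finally show "f' \<cdot> (?p' \<cdot> lam W x') = f' \<cdot> One C (Dom C x')" .
  qed
  then have "R_map C W (x', ?p')"
    unfolding R_map_def using p' P by (simp add: hom_def)
  then show ?thesis
    unfolding R_mor_def R_pullback_def using A sq p' eq by simp
qed

lemma R_type_category: "type_category T"
proof (unfold_locales, unfold T_simps)
  fix \<Gamma> A assume "R_map C W A \<and> Cod C (fst A) = \<Gamma>"
  then show "fst A \<in> hom C (Dom C (fst A)) \<Gamma>" using R_mapD by (simp add: hom_def)
next
  fix f \<Delta> \<Gamma> A assume f: "f \<in> hom C \<Delta> \<Gamma>" and A: "R_map C W A \<and> Cod C (fst A) = \<Gamma>"
  then have m: "R_mor C W (R_pullback C W pb f A) A (snd (pb f (fst A))) f"
    and pull: "is_pullback C f (fst A) (fst (pb f (fst A))) (snd (pb f (fst A)))"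
    using R_pullback_mor[of f A] pb_pullback[of f "fst A"] R_mapD by (auto simp: hom_def)
  show "R_map C W (R_pullback C W pb f A) \<and> Cod C (fst (R_pullback C W pb f A)) = \<Delta>"
    using m pullbackD[OF pull] f by (simp add: R_mor_def hom_def)
  show "pullback_square C (fst (R_pullback C W pb f A)) (fst A) (snd (pb f (fst A))) f"
    using m pull by (simp add: R_mor_def pullback_square_def)
qed (use dom_cod one_hom comp_hom one_left one_right assoc in auto)

end

sublocale R_types \<subseteq> types: type_category "R_type_category C W pb"
  by (rule R_type_category)

section \<open>Transport of L-structures along telescopes by the Frobenius property\<close>

locale Frobenius_types = R_types +
  fixes Phi :: "'b \<times> 'b \<Rightarrow> 'b \<times> 'b \<Rightarrow> 'b \<Rightarrow> 'b \<Rightarrow> 'b"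
  assumes Frob: "functorially_Frobenius C W Phi"
begin

text \<open>One Frobenius step per type: the L-map is pulled back along the projection of
  \<open>B\<close>, an R-map. The projections appear swapped because the chosen pullback has
  \<open>fst is\<close> as its first leg, whereas \<open>Phi\<close> expects the R-map
  first.\<close>

primrec tel_L :: "'b \<times> 'b \<Rightarrow> ('b \<times> 'b) list \<Rightarrow> 'b \<times> 'b" where
  "tel_L is [] = is"
| "tel_L is (B # Bs) =
     tel_L (snd (pb (fst is) (fst B)),
            Phi B is (snd (pb (fst is) (fst B))) (fst (pb (fst is) (fst B)))) Bs"

lemma fst_tel_L: "fst (tel_L is Bs) = tel_Lft T (fst is) Bs"
  by (induction Bs arbitrary: "is") auto

lemma Frobenius_pullback:
  assumes "L_map C W is" "R_map C W B" "Cod C (fst B) = Cod C (fst is)"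
  shows "is_pullback C (fst B) (fst is) (snd (pb (fst is) (fst B))) (fst (pb (fst is) (fst B)))"
  using assms by (intro pullback_sym[OF pb_pullback]) (auto dest: L_mapD R_mapD)

lemma tel_L_map:
  assumes "L_map C W is" "is_tel T (Cod C (fst is)) Bs"
  shows "L_map C W (tel_L is Bs)"
  using assms
proof (induction Bs arbitrary: "is")
  case (Cons B Bs)
  then have pull: "is_pullback C (fst B) (fst is) (snd (pb (fst is) (fst B))) (fst (pb (fst is) (fst B)))"
    by (intro Frobenius_pullback) auto
  moreover have "R_map C W B" using Cons.prems by simp
  ultimately have "L_map C W (snd (pb (fst is) (fst B)),
      Phi B is (snd (pb (fst is) (fst B))) (fst (pb (fst is) (fst B))))"
    using Frob Cons.prems(1) unfolding functorially_Frobenius_def by blast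
  from Cons.IH[OF this] show ?case using Cons.prems pullbackD[OF pull] by simp
qed simp

text \<open>Induction on the telescope, using at each type the action of Frobenius on morphisms; the
  R-morphism needed is the substitution square of \<open>B\<close>. The equation on projections is
  carried along so that \<open>k\<close> can be identified afterwards.\<close>

lemma tel_L_mor:
  assumes "L_mor C W is' is h \<theta>" "is_tel T (Cod C (fst is)) Bs"
  shows "\<exists>k. L_mor C W (tel_L is' (tel_Sub T \<theta> Bs)) (tel_L is Bs) k (tel_Lft T \<theta> Bs) \<and>
    tel_Prj T (Dom C (fst is)) (tel_Sub T (fst is) Bs) \<cdot> k =
    h \<cdot> tel_Prj T (Dom C (fst is')) (tel_Sub T (fst is') (tel_Sub T \<theta> Bs))"
  using assms
proof (induction Bs arbitrary: "is" is' h \<theta>)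
  case Nil
  then have "square C (fst is') (fst is) h \<theta>" by (simp add: L_mor_def)
  from squareD[OF this] Nil show ?case by (auto simp: cat_simps)
next
  case (Cons B Bs)
  let ?i = "fst is" and ?i' = "fst is'"
  let ?B' = "R_pullback C W pb \<theta> B"
  let ?\<theta> = "snd (pb \<theta> (fst B))"
  have L: "L_map C W is" "L_map C W is'" and sq: "square C ?i' ?i h \<theta>"
    using Cons.prems by (auto simp: L_mor_def)
  note S = squareD[OF sq]
  have B: "R_map C W B" "Cod C (fst B) = Cod C ?i" using Cons.prems by auto
  have m: "R_mor C W ?B' B ?\<theta> \<theta>" using R_pullback_mor[of \<theta> B] B S by simp
  then have B': "R_map C W ?B'" and sqB: "square C (fst ?B') (fst B) ?\<theta> \<theta>" by (auto simp: R_mor_def)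
  note SB = squareD[OF sqB]
  have pull: "is_pullback C (fst B) ?i (snd (pb ?i (fst B))) (fst (pb ?i (fst B)))"
    using Frobenius_pullback L B by simp
  have pull': "is_pullback C (fst ?B') ?i' (snd (pb ?i' (fst ?B'))) (fst (pb ?i' (fst ?B')))"
    using Frobenius_pullback[OF L(2) B'] SB S by simp
  note P = pullbackD[OF pull] and P' = pullbackD[OF pull']
  let ?j = "snd (pb ?i (fst B))" and ?u = "fst (pb ?i (fst B))"
    and ?j' = "snd (pb ?i' (fst ?B'))" and ?u' = "fst (pb ?i' (fst ?B'))"
  \<comment> \<open>Precisely the domain component that functoriality of Frobenius supplies.\<close>
  let ?h = "induced C ?j ?u (?\<theta> \<cdot> ?j') (h \<cdot> ?u')"
  have Lm: "L_mor C W (?j', Phi ?B' is' ?j' ?u') (?j, Phi B is ?j ?u) ?h ?\<theta>"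
    using Frob pull pull' m Cons.prems(1) unfolding functorially_Frobenius_def by blast
  have "is_tel T (Cod C (fst (?j, Phi B is ?j ?u))) Bs" using Cons.prems P by simp
  from Cons.IH[OF Lm this] obtain k where
    k: "L_mor C W (tel_L is' (tel_Sub T \<theta> (B # Bs))) (tel_L is (B # Bs)) k (tel_Lft T \<theta> (B # Bs))"
    and eq: "tel_Prj T (Dom C ?j) (tel_Sub T ?j Bs) \<cdot> k =
      ?h \<cdot> tel_Prj T (Dom C ?j') (tel_Sub T ?j' (tel_Sub T ?\<theta> Bs))"
    by auto
  let ?q = "tel_Prj T (Dom C ?j) (tel_Sub T ?j Bs)"
    and ?q' = "tel_Prj T (Dom C ?j') (tel_Sub T ?j' (tel_Sub T ?\<theta> Bs))"
  have jh: "?j \<in> hom C (Dom C ?j) (Dom C (fst B))" using P by (simp add: hom_def)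
  have jh': "?j' \<in> hom C (Dom C ?j') (Dom C (fst ?B'))" using P' by (simp add: hom_def)
  have tB: "is_tel T (Dom C (fst B)) Bs" using Cons.prems by simp
  have th: "?\<theta> \<in> hom C (Dom C (fst ?B')) (Dom C (fst B))" using SB by (simp add: hom_def)
  have tB': "is_tel T (Dom C (fst ?B')) (tel_Sub T ?\<theta> Bs)"
    using types.is_tel_tel_Sub[of ?\<theta>] th tB by simp
  note Q = pullbackD[OF types.tel_pullback[of ?j, simplified, OF jh tB]]
  note Q' = pullbackD[OF types.tel_pullback[of ?j', simplified, OF jh'[simplified] tB'[simplified]]]
  \<comment> \<open>Four faces of a cube with the two Frobenius pullbacks as ends, read in turn;
    this cone condition yields \<open>?u \<cdot> ?h = h \<cdot> ?u'\<close>.\<close>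
  have "fst B \<cdot> (?\<theta> \<cdot> ?j') = ?i \<cdot> (h \<cdot> ?u')"
  proof -
    have "fst B \<cdot> (?\<theta> \<cdot> ?j') = (fst B \<cdot> ?\<theta>) \<cdot> ?j'" using P P' SB by (subst comp_assoc) auto
    also have "\<dots> = \<theta> \<cdot> (fst ?B' \<cdot> ?j')" unfolding SB(9) using P P' SB by (subst comp_assoc) auto
    also have "\<dots> = (\<theta> \<cdot> ?i') \<cdot> ?u'" unfolding P'(9) using P' S by (subst comp_assoc) auto
    also have "\<dots> = ?i \<cdot> (h \<cdot> ?u')" unfolding S(9)[symmetric] using P' S by (subst comp_assoc) auto
    finally show ?thesis .
  qed
  then have H: "?h \<in> Arr C" "Dom C ?h = Dom C ?u'" "Cod C ?h = Dom C ?u" "?u \<cdot> ?h = h \<cdot> ?u'"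
    using pullback_induced[OF pull, of "?\<theta> \<cdot> ?j'" "h \<cdot> ?u'"] P P' SB S
    by (auto simp: comp_arr)
  have K: "square C (tel_Lft T ?j' (tel_Sub T ?\<theta> Bs)) (tel_Lft T ?j Bs) k (tel_Lft T ?\<theta> Bs)"
    using k by (simp add: L_mor_def fst_tel_L)
  note K = squareD[OF K]
  have "(?u \<cdot> ?q) \<cdot> k = ?u \<cdot> (?q \<cdot> k)" using P Q K by (subst comp_assoc) auto
  also have "\<dots> = (?u \<cdot> ?h) \<cdot> ?q'" unfolding eq using P H Q' P' by (subst comp_assoc) auto
  also have "\<dots> = h \<cdot> (?u' \<cdot> ?q')" unfolding H(4) using S P' Q' by (subst comp_assoc) auto
  finally have "(?u \<cdot> ?q) \<cdot> k = h \<cdot> (?u' \<cdot> ?q')" .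
  with k show ?case
    by (intro exI[of _ k] conjI)
      (simp_all only: tel_Prj.simps tel_Sub.simps T_simps fst_R_pullback P(6) P'(6)[simplified])
qed

text \<open>The witness \<open>k\<close> has the prescribed composite with the telescope projection,
  and its composite with the telescope lift is prescribed by its square. Uniqueness in the pullback
  therefore makes it the explicit map used in \<open>base_map\<close>.\<close>

lemma tel_L_mor_induced:
  assumes m: "L_mor C W is' is h \<theta>" and t: "is_tel T (Cod C (fst is)) Bs"
  shows "L_mor C W (tel_L is' (tel_Sub T \<theta> Bs)) (tel_L is Bs)
    (induced C (tel_Prj T (Dom C (fst is)) (tel_Sub T (fst is) Bs)) (tel_Lft T (fst is) Bs)
       (h \<cdot> tel_Prj T (Dom C (fst is')) (tel_Sub T (fst is') (tel_Sub T \<theta> Bs)))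
       (tel_Lft T \<theta> Bs \<cdot> tel_Lft T (fst is') (tel_Sub T \<theta> Bs)))
    (tel_Lft T \<theta> Bs)"
proof -
  obtain k where k: "L_mor C W (tel_L is' (tel_Sub T \<theta> Bs)) (tel_L is Bs) k (tel_Lft T \<theta> Bs)"
    "tel_Prj T (Dom C (fst is)) (tel_Sub T (fst is) Bs) \<cdot> k =
       h \<cdot> tel_Prj T (Dom C (fst is')) (tel_Sub T (fst is') (tel_Sub T \<theta> Bs))"
    using tel_L_mor[OF assms] by blast
  have "square C (fst is') (fst is) h \<theta>" using m by (simp add: L_mor_def)
  note S = squareD[OF this]
  have "square C (tel_Lft T (fst is') (tel_Sub T \<theta> Bs)) (tel_Lft T (fst is) Bs) k (tel_Lft T \<theta> Bs)"
    using k by (simp add: L_mor_def fst_tel_L)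
  note K = squareD[OF this]
  have pull: "is_pullback C (fst is) (tel_Prj T (Cod C (fst is)) Bs)
      (tel_Prj T (Dom C (fst is)) (tel_Sub T (fst is) Bs)) (tel_Lft T (fst is) Bs)"
    using types.tel_pullback[of "fst is" "Dom C (fst is)", OF _ t] S by (simp add: hom_def)
  note P = pullbackD[OF pull]
  have "induced C (tel_Prj T (Dom C (fst is)) (tel_Sub T (fst is) Bs)) (tel_Lft T (fst is) Bs)
      (tel_Prj T (Dom C (fst is)) (tel_Sub T (fst is) Bs) \<cdot> k) (tel_Lft T (fst is) Bs \<cdot> k) = k"
    by (rule induced_eqI[OF pull]) (use K P in \<open>auto simp: hom_def comp_arr\<close>)
  then show ?thesis
    using k(1) unfolding k(2) K(9) by simp
qed

end

section \<open>Identity types from the diagonal factorisations\<close>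

locale homotopy_model = Frobenius_types +
  fixes D :: "'b diag"
  assumes diag: "diagonal_factorisations C W pb D"
    and fdiag: "functorial_diagonal C W pb D"
    and sdiag: "stable_diagonal C W pb D"
begin

text \<open>The R-part of the diagonal factorisation is the identity type and the L-part is
  reflexivity. The eliminator fills a square whose bottom side is an identity, so its lower triangle
  says that it is a section.\<close>

definition Id_types :: "('a, 'b, 'b \<times> 'b) idty" where
  "Id_types = \<lparr>
     Idt = (\<lambda>\<Gamma>. jR D),
     refl_map = (\<lambda>\<Gamma> A. fst (iL D A)),
     Jel = (\<lambda>\<Gamma> A Bs K d. lift C W (tel_L (iL D A) Bs) K d (One C (Cod C (fst K)))) \<rparr>"

lemma Id_types_simps [simp]:
  "Idt Id_types \<Gamma> A = jR D A" "refl_map Id_types \<Gamma> A = fst (iL D A)"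
  "Jel Id_types \<Gamma> A Bs K d = lift C W (tel_L (iL D A) Bs) K d (One C (Cod C (fst K)))"
  "Ext3 T Id_types \<Gamma> A = Dom C (fst (jR D A))"
  by (simp_all add: Id_types_def Ext3_def)

text \<open>These agree on the nose, not just up to isomorphism, because substitution and the fibre
  product use the same chosen pullback.\<close>

lemma context_simps:
  "Ext2 T \<Gamma> A = Dom C (fst (pb (fst A) (fst A)))"
  "diag_ty T \<Gamma> A = diagonal C pb (fst A)"
  "Lft2 T \<Delta> \<Gamma> f A = fibre_prod_map C pb (fst (pb f (fst A))) (fst A) (snd (pb f (fst A)))"
  by (simp_all add: Ext2_def wk_def diag_ty_def diagonal_def Lft2_def fibre_prod_map_def)

lemma diagonalD:
  assumes "R_map C W A"
  shows "L_map C W (iL D A)" "R_map C W (jR D A)" "Dom C (fst (iL D A)) = Dom C (fst A)"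
    "Cod C (fst (iL D A)) = Dom C (fst (jR D A))"
    "Cod C (fst (jR D A)) = Dom C (fst (pb (fst A) (fst A)))"
    "fst (jR D A) \<cdot> fst (iL D A) = diagonal C pb (fst A)"
  using diag assms unfolding diagonal_factorisations_def by blast+

text \<open>Recasts elimination data as a lifting problem: the condition on \<open>d\<close> is a
  commuting square from the transported reflexivity map to \<open>K\<close> over an
  identity.\<close>

lemma elim_dataD:
  assumes A: "R_map C W A" and e: "elim_data T Id_types \<Gamma> A Bs K d"
  shows "is_tel T (Cod C (fst (iL D A))) Bs" "L_map C W (tel_L (iL D A) Bs)" "R_map C W K"
    "square C (fst (tel_L (iL D A) Bs)) (fst K) d (One C (Cod C (fst K)))"
    "Cod C (fst K) = tel_Ext T (Dom C (fst (jR D A))) Bs"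
    "fst (tel_L (iL D A) Bs) = tel_Lft T (fst (iL D A)) Bs"
    "Cod C (tel_Lft T (fst (iL D A)) Bs) = tel_Ext T (Dom C (fst (jR D A))) Bs"
proof -
  note DA = diagonalD[OF A]
  show t: "is_tel T (Cod C (fst (iL D A))) Bs" and K: "R_map C W K"
    and cK: "Cod C (fst K) = tel_Ext T (Dom C (fst (jR D A))) Bs"
    using e DA by (auto simp: elim_data_def)
  show L: "L_map C W (tel_L (iL D A) Bs)" using tel_L_map[OF DA(1) t] .
  show eq: "fst (tel_L (iL D A) Bs) = tel_Lft T (fst (iL D A)) Bs" by (rule fst_tel_L)
  have h: "tel_Lft T (fst (iL D A)) Bs
    \<in> hom C (tel_Ext T (Dom C (fst A)) (tel_Sub T (fst (iL D A)) Bs))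
        (tel_Ext T (Dom C (fst (jR D A))) Bs)"
    using types.tel_Lft_hom[of "fst (iL D A)" "Dom C (fst A)" _ Bs] t DA L_mapD[OF DA(1)]
    by (simp add: hom_def)
  then show "Cod C (tel_Lft T (fst (iL D A)) Bs) = tel_Ext T (Dom C (fst (jR D A))) Bs"
    by (simp add: hom_def)
  show "square C (fst (tel_L (iL D A) Bs)) (fst K) d (One C (Cod C (fst K)))"
    using e h L_mapD[OF L] R_mapD[OF K] cK one_arr[OF cod_ob[OF R_mapD(1)[OF K]]]
    by (intro squareI) (auto simp: elim_data_def eq hom_def cat_simps)
qed

text \<open>Both sides are the canonical filler of one square, from the transported reflexivity map
  of \<open>A'\<close> to \<open>K\<close>. The left side reaches it by naturality in R-morphisms,
  the right side by naturality in L-morphisms.\<close>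

lemma Jel_substitution:
  assumes m: "R_mor C W A' A h f" and A': "A' = R_pullback C W pb f A"
    and e: "elim_data T Id_types \<Gamma> A Bs K d"
  defines "\<theta> \<equiv> Imap D A' A h f"
  assumes h: "h = snd (pb f (fst A))"
  shows "Lft T (tel_Lft T \<theta> Bs) K \<cdot>
      Jel Id_types \<Delta> A' (tel_Sub T \<theta> Bs) (Sub T (tel_Lft T \<theta> Bs) K)
        (elim_sub T Id_types \<Delta> \<Gamma> f A \<theta> Bs K d)
    = Jel Id_types \<Gamma> A Bs K d \<cdot> tel_Lft T \<theta> Bs"
proof -
  have RA: "R_map C W A" "R_map C W A'" using m by (auto simp: R_mor_def)
  note DA = diagonalD[OF RA(1)] and DA' = diagonalD[OF RA(2)]
  note E = elim_dataD[OF RA(1) e]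
  let ?g = "tel_Lft T \<theta> Bs" and ?is = "tel_L (iL D A) Bs"
    and ?is' = "tel_L (iL D A') (tel_Sub T \<theta> Bs)"
  let ?b = "base_map T Id_types \<Delta> \<Gamma> f A \<theta> Bs"
  have "L_mor C W (iL D A') (iL D A) h \<theta>"
    using fdiag m unfolding functorial_diagonal_def \<theta>_def by blast
  \<comment> \<open>The morphism of reflexivity maps, extended over the telescope, has
    \<open>base_map\<close> as its top side.\<close>
  from tel_L_mor_induced[OF this E(1)] have Lm: "L_mor C W ?is' ?is ?b ?g"
    by (simp add: base_map_def Let_def DA DA' A'[symmetric] h[symmetric])
  then have L': "L_map C W ?is'" and sqb: "square C (fst ?is') (fst ?is) ?b ?g"
    by (auto simp: L_mor_def)
  note B = squareD[OF sqb] and S = squareD[OF E(4)] and RK = R_mapD[OF E(3)]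
  let ?K' = "R_pullback C W pb ?g K" and ?g' = "snd (pb ?g (fst K))"
  have gK: "Cod C (fst K) = Cod C ?g" using B E by simp
  have mK: "R_mor C W ?K' K ?g' ?g" using R_pullback_mor[OF B(4) E(3) gK] .
  have pull: "is_pullback C ?g (fst K) (fst ?K') ?g'"
    using pb_pullback[OF B(4) RK(1)] gK by simp
  note P = pullbackD[OF pull]
  let ?d' = "elim_sub T Id_types \<Delta> \<Gamma> f A \<theta> Bs K d"
  have d'_eq: "?d' = induced C (fst ?K') ?g' (fst ?is') (d \<cdot> ?b)"
    by (simp add: elim_sub_def Let_def A'[symmetric] fst_tel_L)
  \<comment> \<open>\<open>d\<close> lies over \<open>fst ?is\<close>, so the square of
    \<open>?b\<close> and \<open>?g\<close> makes the legs defining \<open>?d'\<close>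
    agree.\<close>
  have "?g \<cdot> fst ?is' = fst K \<cdot> (d \<cdot> ?b)"
  proof -
    have "fst K \<cdot> (d \<cdot> ?b) = (fst K \<cdot> d) \<cdot> ?b" using B S by (subst comp_assoc) auto
    also have "\<dots> = fst ?is \<cdot> ?b" unfolding S(9) using S gK B by (subst one_comp) simp_all
    finally show ?thesis using B by simp
  qed
  then have d': "?d' \<in> Arr C" "Dom C ?d' = Dom C (fst ?is')" "Cod C ?d' = Dom C (fst ?K')"
    "fst ?K' \<cdot> ?d' = fst ?is'" "?g' \<cdot> ?d' = d \<cdot> ?b"
    unfolding d'_eq using pullback_induced[OF pull, of "fst ?is'" "d \<cdot> ?b"] B S
    by (auto simp: comp_arr)
  have cK': "Cod C (fst ?K') = Cod C (fst ?is')" using P B by simp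
  have sq': "square C (fst ?is') (fst ?K') ?d' (One C (Cod C (fst ?K')))"
    using d' cK' B P by (intro squareI) (auto simp: cat_simps)
  have "?g' \<cdot> lift C W ?is' ?K' ?d' (One C (Cod C (fst ?K')))
      = lift C W ?is' K (?g' \<cdot> ?d') (?g \<cdot> One C (Cod C (fst ?K')))"
    by (rule lift_R_mor[OF mK L' sq'])
  \<comment> \<open>Moving the identity to the other side of \<open>?g\<close> gives the bottom side
    the form that naturality in L-morphisms expects.\<close>
  also have "\<dots> = lift C W ?is' K (d \<cdot> ?b) (One C (Cod C (fst K)) \<cdot> ?g)"
    using d' cK' B gK by (simp add: cat_simps)
  also have "\<dots> = lift C W ?is K d (One C (Cod C (fst K))) \<cdot> ?g"
    by (rule lift_L_mor[OF Lm E(3,4), symmetric])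
  finally show ?thesis by simp
qed

lemma strong_identity: "strong_identity_types T Id_types"
proof (unfold_locales, unfold T_simps(1))
  fix \<Gamma> A assume "A \<in> Ty T \<Gamma>"
  then have A: "R_map C W A" by simp
  note DA = diagonalD[OF A]
  show "Idt Id_types \<Gamma> A \<in> Ty T (Ext2 T \<Gamma> A)" using DA by (simp add: context_simps)
  show "refl_map Id_types \<Gamma> A \<in> hom C (Ext T \<Gamma> A) (Ext3 T Id_types \<Gamma> A)"
    using DA L_mapD[OF DA(1)] by (simp add: hom_def)
  show "Prj T (Ext2 T \<Gamma> A) (Idt Id_types \<Gamma> A) \<cdot> refl_map Id_types \<Gamma> A = diag_ty T \<Gamma> A"
    using DA by (simp add: context_simps)
  fix Bs K d assume "elim_data T Id_types \<Gamma> A Bs K d"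
  note E = elim_dataD[OF A this]
  show "Jel Id_types \<Gamma> A Bs K d
      \<in> hom C (tel_Ext T (Ext3 T Id_types \<Gamma> A) Bs) (Ext T (tel_Ext T (Ext3 T Id_types \<Gamma> A) Bs) K)"
    using lift_arr[OF E(2-4)] E by (simp add: hom_def)
  show "Jel Id_types \<Gamma> A Bs K d \<cdot> tel_Lft T (refl_map Id_types \<Gamma> A) Bs = d"
    using lift_upper[OF E(2-4)] E by simp
  show "Prj T (tel_Ext T (Ext3 T Id_types \<Gamma> A) Bs) K \<cdot> Jel Id_types \<Gamma> A Bs K d
      = One C (tel_Ext T (Ext3 T Id_types \<Gamma> A) Bs)"
    using lift_lower[OF E(2-4)] E by simp
next
  fix f \<Delta> \<Gamma> A assume f: "f \<in> hom C \<Delta> \<Gamma>" and A: "A \<in> Ty T \<Gamma>"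
  let ?A' = "R_pullback C W pb f A" and ?h = "snd (pb f (fst A))"
  \<comment> \<open>The comparison map is \<open>I\<close> applied to the substitution square.
    Stability makes its square a pullback, and functoriality makes it commute with
    reflexivity.\<close>
  let ?\<theta> = "Imap D ?A' A ?h f"
  have m: "R_mor C W ?A' A ?h f" using R_pullback_mor[of f A] f A by (simp add: hom_def)
  have "pullback_square C (fst ?A') (fst A) ?h f"
    using types.Lft_pullback[of f \<Delta> \<Gamma> A] f A by simp
  with sdiag m have "pullback_square C (fst (jR D ?A')) (fst (jR D A)) ?\<theta>
      (fibre_prod_map C pb (fst ?A') (fst A) ?h)"
    unfolding stable_diagonal_def by blast
  moreover have "?\<theta> \<cdot> fst (iL D ?A') = fst (iL D A) \<cdot> ?h"
  proof -
    have "L_mor C W (iL D ?A') (iL D A) ?h ?\<theta>"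
      using fdiag m unfolding functorial_diagonal_def by blast
    then show ?thesis by (simp add: L_mor_def square_def)
  qed
  ultimately show "\<exists>\<theta>. pullback_square C
        (Prj T (Ext2 T \<Delta> (Sub T f A)) (Idt Id_types \<Delta> (Sub T f A)))
        (Prj T (Ext2 T \<Gamma> A) (Idt Id_types \<Gamma> A)) \<theta> (Lft2 T \<Delta> \<Gamma> f A) \<and>
      \<theta> \<cdot> refl_map Id_types \<Delta> (Sub T f A) = refl_map Id_types \<Gamma> A \<cdot> Lft T f A \<and>
      (\<forall>Bs K d. elim_data T Id_types \<Gamma> A Bs K d \<longrightarrow>
         Lft T (tel_Lft T \<theta> Bs) K \<cdot>
           Jel Id_types \<Delta> (Sub T f A) (tel_Sub T \<theta> Bs) (Sub T (tel_Lft T \<theta> Bs) K)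
             (elim_sub T Id_types \<Delta> \<Gamma> f A \<theta> Bs K d)
         = Jel Id_types \<Gamma> A Bs K d \<cdot> tel_Lft T \<theta> Bs)"
    using Jel_substitution[OF m refl] by (intro exI[of _ ?\<theta>]) (simp add: context_simps)
qed

end

theorem theorem3p9:
  fixes E :: "('o, 'm) cat"
    and W :: "'m wfs"
    and pb :: "'m \<Rightarrow> 'm \<Rightarrow> 'm \<times> 'm"
    and Phi :: "'m \<times> 'm \<Rightarrow> 'm \<times> 'm \<Rightarrow> 'm \<Rightarrow> 'm \<Rightarrow> 'm"
    and D :: "'m diag"
  assumes "category E"
    and "finitely_complete E"
    and "pullback_choice E pb"
    and "cloven_wfs E W"
    and "functorially_Frobenius E W Phi"
    and "diagonal_factorisations E W pb D"
    and "functorial_diagonal E W pb D"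
    and "stable_diagonal E W pb D"
  shows "categorical_model (R_type_category E W pb)"
proof -
  interpret cloven_wfs E W by fact
  interpret homotopy_model E W pb Phi D
    by unfold_locales fact+
  show ?thesis
    unfolding categorical_model_def using R_type_category strong_identity by blast
qed

end
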